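(* Let $(x^0,y^0,z^0)\in\mathcal{F}^o$ and let $L\ge 0$ be such that $\phi(x^0,z^0)=O(\nu L)$. Suppose that $\ln(1/\varepsilon)=O(L)$. Then the feasible inexact potential reduction algorithm (defined in the context) terminates in $O(\nu L)$ iterations, provided that $\kappa$ is chosen independently of $n$.
   Context: Let $A\in\mathbb{R}^{m\times n}$ have full row rank, $b\in\mathbb{R}^m$, $c\in\mathbb{R}^n$. The linear programs are: minimize $c^Tx$ subject to $Ax=b,\ x\ge0$ (primal), and maximize $b^Ty$ subject to $A^Ty+z=c,\ z\ge0$ (dual). The strictly feasible set is $\mathcal{F}^o=\{(x,y,z): Ax=b,\ A^Ty+z=c,\ (x,z)>0\}$, assumed nonempty (inequalities componentwise). $\|\cdot\|$ is the Euclidean norm and $e$ is the $n$-vector of ones. Potential function: for $x,z>0$ in $\mathbb{R}^n$, $\phi(x,z)=(n+\nu)\ln(x^Tz)-\sum_{i=1}^n\ln(x_iz_i)-n\ln n$. Scaled inexact Newton system at $(x^k,y^k,z^k)$ with $x^k,z^k>0$ and parameter $\mu>0$: let $X^k=\mathrm{diag}(x^k)$, $Z^k=\mathrm{diag}(z^k)$, $D=(X^k)^{1/2}(Z^k)^{-1/2}$, $W=(X^kZ^k)^{1/2}$, $w=We$, and $p=b-Ax^k$, $q=D(c-A^Ty^k-z^k)$, $r=-w+\mu W^{-1}e$. The inexact solution $(\Delta u,\Delta y,\Delta v)$ with residual $\xi\in\mathbb{R}^n$ is the solution of $$AD\,\Delta u=p,\qquad DA^T\Delta y+\Delta v=q,\qquad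 \Delta u+\Delta v=r+\xi .$$ Feasible inexact potential reduction algorithm. Given $(x^0,y^0,z^0)\in\mathcal{F}^o$ and $\varepsilon>0$. Choose $\nu\ge\sqrt n$ and $\kappa\in[0,1)$. Set $\delta=0.15(1-\kappa)^4$ and $k=0$. 1. If $(x^k)^Tz^k\le\varepsilon$ then stop. 2. Let $\mu=(x^k)^Tz^k/(n+\nu)$. Compute the solution of the scaled inexact Newton system with residual $\xi$ that satisfies (a) $-r^T\xi\le\kappa\|r\|^2$ and (b) $\|\xi\|\le\kappa\min(\|\Delta u\|,\|\Delta v\|)$. Set $\Delta x=D\Delta u$, $\Delta z=D^{-1}\Delta v$. 3. Find a step size $\alpha^k$ such that $\phi(x^k+\alpha^k\Delta x,z^k+\alpha^k\Delta z)\le\phi(x^k,z^k)-\delta$. 4. Set $(x^{k+1},y^{k+1},z^{k+1})=(x^k,y^k,z^k)+\alpha^k(\Delta x,\Delta y,\Delta z)$, $k:=k+1$, and go to 1. Step sizes are always chosen to keep the iterates $x^k$ and $z^k$ positive. *)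

theory Defs
  imports "HOL-Analysis.L2_Norm" "Jordan_Normal_Form.DL_Rank"
begin

(* The constants hidden in the O-notation must be uniform in the dimensions m and n, so
   vectors and matrices carry their dimensions as numbers and not as types.
   An iterate is a triple (x, y, z). *)
type_synonym iterate = "real vec \<times> real vec \<times> real vec"

definition euclidean_norm :: "real vec \<Rightarrow> real" where
  "euclidean_norm v = L2_set (\<lambda>i. v $ i) {..<dim_vec v}"

definition positive_vec :: "real vec \<Rightarrow> bool" where
  "positive_vec v \<longleftrightarrow> (\<forall>i<dim_vec v. 0 < v $ i)"

definition strictly_feasible :: "real mat \<Rightarrow> real vec \<Rightarrow> real vec \<Rightarrow> iterate set" where
  "strictly_feasible A b c =
     {(x, y, z). x \<in> carrier_vec (dim_col A) \<and> y \<in> carrier_vec (dim_row A) \<and>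
        z \<in> carrier_vec (dim_col A) \<and>
        A *\<^sub>v x = b \<and> transpose_mat A *\<^sub>v y + z = c \<and> positive_vec x \<and> positive_vec z}"

definition potential :: "real \<Rightarrow> real vec \<Rightarrow> real vec \<Rightarrow> real" where
  "potential \<nu> x z =
     (let n = dim_vec x in
        (real n + \<nu>) * ln (x \<bullet> z) - (\<Sum>i<n. ln (x $ i * z $ i)) - real n * ln (real n))"

definition ones :: "nat \<Rightarrow> real vec" where
  "ones n = vec n (\<lambda>_. 1)"

(* The diagonal matrices below are used only for positive x and z; scaling_D_inv and
   scaling_W_inv are then the inverses of scaling_D and scaling_W. *)
definition scaling_D :: "real vec \<Rightarrow> real vec \<Rightarrow> real mat" where
  "scaling_D x z = mat_diag (dim_vec x) (\<lambda>i. sqrt (x $ i) / sqrt (z $ i))"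

definition scaling_D_inv :: "real vec \<Rightarrow> real vec \<Rightarrow> real mat" where
  "scaling_D_inv x z = mat_diag (dim_vec x) (\<lambda>i. sqrt (z $ i) / sqrt (x $ i))"

definition scaling_W :: "real vec \<Rightarrow> real vec \<Rightarrow> real mat" where
  "scaling_W x z = mat_diag (dim_vec x) (\<lambda>i. sqrt (x $ i * z $ i))"

definition scaling_W_inv :: "real vec \<Rightarrow> real vec \<Rightarrow> real mat" where
  "scaling_W_inv x z = mat_diag (dim_vec x) (\<lambda>i. 1 / sqrt (x $ i * z $ i))"

definition centering_rhs :: "real \<Rightarrow> real vec \<Rightarrow> real vec \<Rightarrow> real vec" where
  "centering_rhs \<mu> x z =
     - (scaling_W x z *\<^sub>v ones (dim_vec x)) + \<mu> \<cdot>\<^sub>v (scaling_W_inv x z *\<^sub>v ones (dim_vec x))"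

definition inexact_newton_solution ::
  "real mat \<Rightarrow> real vec \<Rightarrow> real vec \<Rightarrow> real \<Rightarrow> iterate \<Rightarrow> real vec \<Rightarrow>
     real vec \<Rightarrow> real vec \<Rightarrow> real vec \<Rightarrow> bool" where
  "inexact_newton_solution A b c \<mu> = (\<lambda>(x, y, z) \<xi> du dy dv.
     \<xi> \<in> carrier_vec (dim_col A) \<and> du \<in> carrier_vec (dim_col A) \<and>
     dy \<in> carrier_vec (dim_row A) \<and> dv \<in> carrier_vec (dim_col A) \<and>
     (A * scaling_D x z) *\<^sub>v du = b - A *\<^sub>v x \<and>
     (scaling_D x z * transpose_mat A) *\<^sub>v dy + dv
        = scaling_D x z *\<^sub>v (c - transpose_mat A *\<^sub>v y - z) \<and>
     du + dv = centering_rhs \<mu> x z + \<xi>)"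

definition gap_param :: "real \<Rightarrow> real vec \<Rightarrow> real vec \<Rightarrow> real" where
  "gap_param \<nu> x z = (x \<bullet> z) / (real (dim_vec x) + \<nu>)"

definition admissible_residual ::
  "real \<Rightarrow> real vec \<Rightarrow> real vec \<Rightarrow> real vec \<Rightarrow> real vec \<Rightarrow> bool" where
  "admissible_residual \<kappa> r \<xi> du dv \<longleftrightarrow>
     - (r \<bullet> \<xi>) \<le> \<kappa> * (euclidean_norm r)\<^sup>2 \<and>
     euclidean_norm \<xi> \<le> \<kappa> * min (euclidean_norm du) (euclidean_norm dv)"

definition search_direction ::
  "real mat \<Rightarrow> real vec \<Rightarrow> real vec \<Rightarrow> real \<Rightarrow> real \<Rightarrow> iterate \<Rightarrow> iterate \<Rightarrow> bool" where
  "search_direction A b c \<nu> \<kappa> = (\<lambda>(x, y, z) (dx, dy, dz).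
     \<exists>\<xi> du dv. inexact_newton_solution A b c (gap_param \<nu> x z) (x, y, z) \<xi> du dy dv \<and>
       admissible_residual \<kappa> (centering_rhs (gap_param \<nu> x z) x z) \<xi> du dv \<and>
       dx = scaling_D x z *\<^sub>v du \<and> dz = scaling_D_inv x z *\<^sub>v dv)"

definition reduction :: "real \<Rightarrow> real" where
  "reduction \<kappa> = 0.15 * (1 - \<kappa>) ^ 4"

fun move :: "real \<Rightarrow> iterate \<Rightarrow> iterate \<Rightarrow> iterate" where
  "move \<alpha> (dx, dy, dz) (x, y, z) = (x + \<alpha> \<cdot>\<^sub>v dx, y + \<alpha> \<cdot>\<^sub>v dy, z + \<alpha> \<cdot>\<^sub>v dz)"

definition acceptable_move :: "real \<Rightarrow> real \<Rightarrow> iterate \<Rightarrow> iterate \<Rightarrow> bool" where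
  "acceptable_move \<nu> \<kappa> = (\<lambda>(x, y, z) (x', y', z').
     positive_vec x' \<and> positive_vec z' \<and>
     potential \<nu> x' z' \<le> potential \<nu> x z - reduction \<kappa>)"

definition stopped :: "real \<Rightarrow> iterate \<Rightarrow> bool" where
  "stopped \<epsilon> = (\<lambda>(x, y, z). x \<bullet> z \<le> \<epsilon>)"

definition algorithm_step ::
  "real mat \<Rightarrow> real vec \<Rightarrow> real vec \<Rightarrow> real \<Rightarrow> real \<Rightarrow> real \<Rightarrow> iterate \<Rightarrow> iterate \<Rightarrow> bool" where
  "algorithm_step A b c \<nu> \<kappa> \<epsilon> s s' \<longleftrightarrow>
     \<not> stopped \<epsilon> s \<and>
     (\<exists>d \<alpha>. search_direction A b c \<nu> \<kappa> s d \<and> s' = move \<alpha> d s \<and> acceptable_move \<nu> \<kappa> s s')"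

definition algorithm_run ::
  "real mat \<Rightarrow> real vec \<Rightarrow> real vec \<Rightarrow> real \<Rightarrow> real \<Rightarrow> real \<Rightarrow> iterate \<Rightarrow> nat \<Rightarrow> (nat \<Rightarrow> iterate) \<Rightarrow> bool"
  where
  "algorithm_run A b c \<nu> \<kappa> \<epsilon> s0 N s \<longleftrightarrow>
     s 0 = s0 \<and> (\<forall>k<N. algorithm_step A b c \<nu> \<kappa> \<epsilon> (s k) (s (Suc k)))"

(* The residual, the direction and the step size are free choices. Termination is required
   for all of them: no run is longer than B, and no run gets stuck before the stopping
   test succeeds, i.e. a search direction exists, and every search direction that may have been
   computed admits a (positive) step size. *)
definition terminates_within ::
  "real mat \<Rightarrow> real vec \<Rightarrow> real vec \<Rightarrow> real \<Rightarrow> real \<Rightarrow> real \<Rightarrow> iterate \<Rightarrow> int \<Rightarrow> bool" where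
  "terminates_within A b c \<nu> \<kappa> \<epsilon> s0 B \<longleftrightarrow>
     (\<forall>N s. algorithm_run A b c \<nu> \<kappa> \<epsilon> s0 N s \<longrightarrow>
        int N \<le> B \<and>
        (\<not> stopped \<epsilon> (s N) \<longrightarrow>
           (\<exists>d. search_direction A b c \<nu> \<kappa> (s N) d) \<and>
           (\<forall>d. search_direction A b c \<nu> \<kappa> (s N) d \<longrightarrow>
              (\<exists>\<alpha>>0. acceptable_move \<nu> \<kappa> (s N) (move \<alpha> d (s N))))))"

end

theory Submission
  imports Defs
begin

text \<open>
  In the scaled variables the step from \<open>(w, w)\<close> is \<open>(\<Delta>u, \<Delta>v)\<close> with \<open>\<Delta>u \<bullet> \<Delta>v = 0\<close> and
  \<open>\<Delta>u + \<Delta>v = r + \<xi>\<close>, and the derivative of the potential along it is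
  \<open>- r \<bullet> (r + \<xi>) / \<mu> \<le> - (1 - \<kappa>) \<parallel>r\<parallel>\<^sup>2 / \<mu>\<close>. With
  \<open>\<alpha> = \<tau> min w / \<parallel>r + \<xi>\<parallel>\<close> the second-order terms are at most \<open>\<tau>\<^sup>2\<close>. Since
  \<open>\<parallel>r + \<xi>\<parallel> \<le> \<parallel>r\<parallel> / (1 - \<kappa>)\<close>, and \<open>min w \<cdot> \<parallel>r\<parallel> \<ge> (\<surd>3 / 2) \<mu>\<close> because \<open>\<nu> \<ge> \<surd>n\<close>, the choice
  \<open>\<tau> = 0.4 (1 - \<kappa>)\<^sup>2\<close> gives a decrease of at least \<open>0.16 (1 - \<kappa>)\<^sup>4\<close>. By the inequality of
  arithmetic and geometric means the potential dominates \<open>\<nu> ln (x\<^sup>Tz)\<close>, hence exceeds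
  \<open>\<nu> ln \<epsilon>\<close> before termination, so the number of steps is at most a constant times \<open>\<nu> L\<close>.
  A direction always exists, since full row rank makes \<open>AD(AD)\<^sup>T\<close> nonsingular.
\<close>

section \<open>Inequalities for logarithms and for the centering right-hand side\<close>

text \<open>The difference of the two sides has derivative \<open>x * (2 * x + 1) / (1 + x)\<close>,
  which is nonpositive on [-1/2, 0] and nonnegative beyond, so the difference is smallest at
  0.\<close>

lemma ln_one_plus_ge_quadratic:
  fixes t :: real
  assumes "\<bar>t\<bar> \<le> 1 / 2"
  shows "t - t\<^sup>2 \<le> ln (1 + t)"
proof -
  define f where "f = (\<lambda>t::real. ln (1 + t) - t + t\<^sup>2)"
  have deriv: "(f has_real_derivative x * (2 * x + 1) / (1 + x)) (at x)" if "- (1 / 2) \<le> x" for x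
    unfolding f_def using that
    by (auto intro!: derivative_eq_intros simp: field_simps power2_eq_square)
  have "f 0 \<le> f t"
  proof (cases "0 \<le> t")
    case True
    have "\<exists>y. (f has_real_derivative y) (at x) \<and> 0 \<le> y" if "0 \<le> x" for x
      using deriv[of x] that by (intro exI[of _ "x * (2 * x + 1) / (1 + x)"]) auto
    then show ?thesis by (rule DERIV_nonneg_imp_nondecreasing[OF True])
  next
    case False
    have "\<exists>y. (f has_real_derivative y) (at x) \<and> y \<le> 0" if "t \<le> x" "x \<le> 0" for x
      using deriv[of x] that assms
      by (intro exI[of _ "x * (2 * x + 1) / (1 + x)"]) (auto simp: divide_le_0_iff mult_le_0_iff)
    moreover have "t \<le> 0" using False by simp
    ultimately show ?thesis by (intro DERIV_nonpos_imp_nonincreasing[of t 0])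
  qed
  then show ?thesis by (simp add: f_def)
qed

text \<open>This is the inequality of arithmetic and geometric means in logarithmic form. Each
  \<open>ln (h i)\<close> lies below the tangent to \<open>ln\<close> at the mean \<open>M\<close>,
  and the linear terms of these tangents cancel in the sum.\<close>

lemma sum_ln_le_ln_mean:
  fixes h :: "'a \<Rightarrow> real"
  assumes "finite I" "I \<noteq> {}" and pos: "\<And>i. i \<in> I \<Longrightarrow> 0 < h i"
  shows "(\<Sum>i\<in>I. ln (h i)) \<le> card I * ln ((\<Sum>i\<in>I. h i) / card I)"
proof -
  define M where "M = (\<Sum>i\<in>I. h i) / card I"
  have card: "0 < card I" using assms by (simp add: card_gt_0_iff)
  have M: "0 < M" unfolding M_def using assms card by (intro divide_pos_pos sum_pos) auto
  have "(\<Sum>i\<in>I. ln (h i)) \<le> (\<Sum>i\<in>I. ln M + (h i / M - 1))"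
  proof (rule sum_mono)
    fix i assume "i \<in> I"
    then have "ln (h i / M) \<le> h i / M - 1"
      using pos M by (intro ln_le_minus_one) auto
    then show "ln (h i) \<le> ln M + (h i / M - 1)"
      using pos[OF \<open>i \<in> I\<close>] M by (simp add: ln_div)
  qed
  also have "\<dots> = card I * ln M + ((\<Sum>i\<in>I. h i) / M - card I)"
    by (simp add: sum.distrib sum_subtractf sum_divide_distrib)
  also have "(\<Sum>i\<in>I. h i) / M = card I"
    using M card by (simp add: M_def field_simps)
  finally show ?thesis by (simp add: M_def)
qed

text \<open>The vector with entries \<open>1 / w i\<close> splits into a multiple of \<open>w\<close> and a part orthogonal to \<open>w\<close>;
  the two parts give the two nonnegative contributions.\<close>
lemma centering_rhs_lower_bound:
  fixes w :: "'a \<Rightarrow> real" and \<nu> \<mu> :: real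
  assumes I: "finite I" "j \<in> I" and pos: "\<And>i. i \<in> I \<Longrightarrow> 0 < w i"
    and \<nu>: "sqrt (card I) \<le> \<nu>" and \<mu>: "\<mu> = (\<Sum>i\<in>I. (w i)\<^sup>2) / (card I + \<nu>)"
  shows "3 / 4 * \<mu>\<^sup>2 \<le> (w j)\<^sup>2 * (\<Sum>i\<in>I. (\<mu> / w i - w i)\<^sup>2)"
proof -
  define n where "n = real (card I)"
  have n: "1 \<le> n" using I by (auto simp: n_def Suc_le_eq card_gt_0_iff)
  have nu0: "0 < \<nu>" using \<nu> n n_def by (smt (verit) real_sqrt_ge_one)
  have nu2: "n \<le> \<nu>\<^sup>2" using \<nu> n n_def nu0 by (metis real_sqrt_le_iff real_sqrt_unique less_imp_le)
  have S0: "0 < (\<Sum>i\<in>I. (w i)\<^sup>2)" using I pos by (intro sum_pos) force+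
  have mu0: "0 < \<mu>" using S0 n nu0 by (simp add: \<mu> n_def[symmetric])
  have S: "(\<Sum>i\<in>I. (w i)\<^sup>2) = \<mu> * (n + \<nu>)"
    using n nu0 by (simp add: \<mu> n_def[symmetric])
  define H where "H = (\<Sum>i\<in>I. 1 / (w i)\<^sup>2)"
  have expand: "(\<Sum>i\<in>I. (a / w i - b * w i)\<^sup>2) = a\<^sup>2 * H - 2 * a * b * n + b\<^sup>2 * (\<mu> * (n + \<nu>))"
    for a b
  proof -
    have "(\<Sum>i\<in>I. (a / w i - b * w i)\<^sup>2) = (\<Sum>i\<in>I. a\<^sup>2 * (1 / (w i)\<^sup>2) - 2 * a * b + b\<^sup>2 * (w i)\<^sup>2)"
      using pos by (intro sum.cong) (force simp: power2_eq_square field_simps)+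
    then show ?thesis
      by (simp only: sum.distrib sum_subtractf sum_distrib_left[symmetric] H_def S) (simp add: n_def)
  qed
  \<comment> \<open>With this coefficient the vector with entries
    \<open>\<mu> / w i - \<beta> * w i\<close> is orthogonal to \<open>w\<close>. The remaining
    multiple \<open>(1 - \<beta>) * w i\<close> has squared norm
    \<open>\<mu> * \<nu>\<^sup>2 / (n + \<nu>)\<close>.\<close>
  define \<beta> where "\<beta> = n / (n + \<nu>)"
  have \<beta>: "\<beta> * (n + \<nu>) = n" using n nu0 by (simp add: \<beta>_def)
  define t where "t = (w j)\<^sup>2 / \<mu>"
  have t: "(w j)\<^sup>2 = \<mu> * t" "0 < t" using mu0 pos[OF I(2)] by (simp_all add: t_def)
  have r: "(\<Sum>i\<in>I. (\<mu> / w i - w i)\<^sup>2) = (\<Sum>i\<in>I. (\<mu> / w i - \<beta> * w i)\<^sup>2) + \<mu> * \<nu>\<^sup>2 / (n + \<nu>)"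
  proof -
    have "\<nu>\<^sup>2 / (n + \<nu>) = \<nu> - n + \<beta> * n"
      using n nu0 unfolding \<beta>_def by (simp add: field_simps power2_eq_square)
    then have "\<mu> * \<nu>\<^sup>2 / (n + \<nu>) = \<mu> * (\<nu> - n + \<beta> * n)"
      by (simp flip: times_divide_eq_right)
    moreover have "\<beta>\<^sup>2 * (\<mu> * (n + \<nu>)) = \<mu> * (\<beta> * n)"
      using \<beta> by (simp add: power2_eq_square mult_ac)
    ultimately show ?thesis
      using expand[of \<mu> 1] expand[of \<mu> \<beta>] by (simp add: algebra_simps)
  qed
  \<comment> \<open>Of the orthogonal part only the coordinate \<open>j\<close> is kept.\<close>
  have "(\<mu> / w j - \<beta> * w j)\<^sup>2 \<le> (\<Sum>i\<in>I. (\<mu> / w i - \<beta> * w i)\<^sup>2)"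
    using I by (intro member_le_sum) auto
  then have "(w j)\<^sup>2 * ((\<mu> / w j - \<beta> * w j)\<^sup>2 + \<mu> * \<nu>\<^sup>2 / (n + \<nu>))
      \<le> (w j)\<^sup>2 * (\<Sum>i\<in>I. (\<mu> / w i - w i)\<^sup>2)"
    unfolding r by (intro mult_left_mono) auto
  moreover have "(w j)\<^sup>2 * ((\<mu> / w j - \<beta> * w j)\<^sup>2 + \<mu> * \<nu>\<^sup>2 / (n + \<nu>))
      = \<mu>\<^sup>2 * ((1 - \<beta> * t)\<^sup>2 + t * \<nu>\<^sup>2 / (n + \<nu>))"
  proof -
    have "(w j)\<^sup>2 * (\<mu> / w j - \<beta> * w j)\<^sup>2 = (\<mu> - \<beta> * (w j)\<^sup>2)\<^sup>2"
      using pos[OF I(2)] by (simp add: field_simps power2_eq_square)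
    then show ?thesis unfolding distrib_left t(1) by (simp add: field_simps power2_eq_square)
  qed
  \<comment> \<open>Put \<open>s = \<beta> * t\<close>. Since \<open>\<nu>\<^sup>2\<close> is at
    least \<open>n\<close>, the last term is at least \<open>s\<close>, and
    \<open>(1 - s)\<^sup>2 + s = (s - 1 / 2)\<^sup>2 + 3 / 4\<close>.\<close>
  moreover have "3 / 4 \<le> (1 - \<beta> * t)\<^sup>2 + t * \<nu>\<^sup>2 / (n + \<nu>)"
  proof -
    have "\<beta> * t \<le> t * \<nu>\<^sup>2 / (n + \<nu>)"
      using nu2 t n nu0 unfolding \<beta>_def by (simp add: divide_right_mono mult.commute)
    moreover have "3 / 4 \<le> (1 - \<beta> * t)\<^sup>2 + \<beta> * t"
      using zero_le_power2[of "\<beta> * t - 1 / 2"] by (simp add: power2_eq_square algebra_simps)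
    ultimately show ?thesis by linarith
  qed
  then have "\<mu>\<^sup>2 * (3 / 4) \<le> \<mu>\<^sup>2 * ((1 - \<beta> * t)\<^sup>2 + t * \<nu>\<^sup>2 / (n + \<nu>))"
    by (intro mult_left_mono) auto
  ultimately show ?thesis by linarith
qed

section \<open>Decrease of the potential in scaled coordinates\<close>

text \<open>Scaling turns both \<open>x\<close> and \<open>z\<close> into \<open>w\<close>, which
  reduces one iteration to a statement about finite families of reals. The logarithm of the gap is
  bounded above by a tangent, the barrier below by a quadratic. Orthogonality of \<open>u\<close>
  and \<open>v\<close> makes the gap linear in the step size.\<close>

lemma scaled_potential_reduction:
  fixes w u v r \<xi> :: "'a \<Rightarrow> real" and \<kappa> \<nu> \<mu> :: real
  assumes I: "finite I" "I \<noteq> {}" and pos: "\<And>i. i \<in> I \<Longrightarrow> 0 < w i"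
    and \<nu>: "sqrt (card I) \<le> \<nu>" and \<mu>: "\<mu> = (\<Sum>i\<in>I. (w i)\<^sup>2) / (card I + \<nu>)"
    and \<kappa>: "0 \<le> \<kappa>" "\<kappa> < 1"
    and r: "\<And>i. i \<in> I \<Longrightarrow> r i = \<mu> / w i - w i"
    and uv: "\<And>i. i \<in> I \<Longrightarrow> u i + v i = r i + \<xi> i"
    and orth: "(\<Sum>i\<in>I. u i * v i) = 0"
    and angle: "- (\<Sum>i\<in>I. r i * \<xi> i) \<le> \<kappa> * (L2_set r I)\<^sup>2"
    and small: "L2_set \<xi> I \<le> \<kappa> * L2_set u I"
  obtains \<alpha> where "0 < \<alpha>" "\<And>i. i \<in> I \<Longrightarrow> 0 < w i + \<alpha> * u i" "\<And>i. i \<in> I \<Longrightarrow> 0 < w i + \<alpha> * v i"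
    "(card I + \<nu>) * ln (\<Sum>i\<in>I. (w i + \<alpha> * u i) * (w i + \<alpha> * v i))
        - (\<Sum>i\<in>I. ln ((w i + \<alpha> * u i) * (w i + \<alpha> * v i)))
      \<le> (card I + \<nu>) * ln (\<Sum>i\<in>I. (w i)\<^sup>2) - (\<Sum>i\<in>I. ln ((w i)\<^sup>2)) - 0.15 * (1 - \<kappa>) ^ 4"
proof -
  \<comment> \<open>The smallest entry of \<open>w\<close> limits the step: a step size proportional
    to \<open>w j\<close> bounds all relative changes of the entries at once.\<close>
  define j where "j = arg_min_on w I"
  have j: "j \<in> I" "\<And>i. i \<in> I \<Longrightarrow> w j \<le> w i"
    using arg_min_if_finite[OF I, of w] by (auto simp: j_def not_less)
  have wj: "0 < w j" using j pos by auto
  define N where "N = card I + \<nu>"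
  have N: "0 < N" using \<nu> I by (simp add: N_def add_pos_nonneg card_gt_0_iff order_trans[OF _ \<nu>])
  define S where "S = (\<Sum>i\<in>I. (w i)\<^sup>2)"
  have S: "0 < S" unfolding S_def using I pos by (intro sum_pos) force+
  have mu0: "0 < \<mu>" using S N by (simp add: \<mu> N_def S_def)
  have NS: "N / S = 1 / \<mu>" using S N by (simp add: \<mu> N_def S_def)
  define R where "R = L2_set r I"
  define G where "G = L2_set (\<lambda>i. r i + \<xi> i) I"
  have R2: "R\<^sup>2 = (\<Sum>i\<in>I. (r i)\<^sup>2)" by (simp add: R_def L2_set_def sum_nonneg)
  have G2: "G\<^sup>2 = (\<Sum>i\<in>I. (u i)\<^sup>2) + (\<Sum>i\<in>I. (v i)\<^sup>2)"
  proof -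
    have "G\<^sup>2 = (\<Sum>i\<in>I. (u i + v i)\<^sup>2)" by (simp add: G_def L2_set_def sum_nonneg uv)
    also have "\<dots> = (\<Sum>i\<in>I. (u i)\<^sup>2) + (\<Sum>i\<in>I. (v i)\<^sup>2) + 2 * (\<Sum>i\<in>I. u i * v i)"
      by (simp add: power2_sum sum.distrib sum_distrib_left mult.assoc)
    finally show ?thesis using orth by simp
  qed
  have G0: "0 \<le> G" and R0: "0 \<le> R" by (simp_all add: G_def R_def)
  \<comment> \<open>The factor \<open>0.8\<close> is a convenient rational below
    \<open>sqrt 3 / 2\<close>, as \<open>0.64 \<le> 3 / 4\<close>.\<close>
  have R_lower: "0.8 * \<mu> \<le> w j * R"
  proof (rule power2_le_imp_le)
    have "3 / 4 * \<mu>\<^sup>2 \<le> (w j * R)\<^sup>2"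
      using centering_rhs_lower_bound[OF I(1) j(1) pos \<nu> \<mu>] r R2 by (simp add: power_mult_distrib)
    then show "(0.8 * \<mu>)\<^sup>2 \<le> (w j * R)\<^sup>2"
      unfolding power_mult_distrib by (rule order_trans[rotated]) (simp add: power2_eq_square)
  qed (use wj R0 in auto)
  have R: "0 < R" using R_lower mu0 wj R0 by (cases "R = 0") auto
  \<comment> \<open>By the Pythagorean identity \<open>G2\<close> the norm of \<open>u\<close> is at
    most \<open>G\<close>, so the residual is at most \<open>\<kappa> * G\<close> and can be
    absorbed after the triangle inequality.\<close>
  have "L2_set u I \<le> G"
  proof (rule power2_le_imp_le[OF _ G0])
    show "(L2_set u I)\<^sup>2 \<le> G\<^sup>2" unfolding G2 by (simp add: L2_set_def sum_nonneg)
  qed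
  then have "L2_set \<xi> I \<le> \<kappa> * G" using small \<kappa> by (meson mult_left_mono order_trans)
  moreover have "G \<le> R + L2_set \<xi> I" unfolding G_def R_def by (rule L2_set_triangle_ineq)
  ultimately have GR: "(1 - \<kappa>) * G \<le> R" by (simp add: algebra_simps)
  define q where "q = (1 - \<kappa>)\<^sup>2"
  have q: "0 < q" "q \<le> 1" using \<kappa> by (auto simp: q_def power_le_one)
  define P where "P = (\<Sum>i\<in>I. r i * (r i + \<xi> i))"
  have P: "(1 - \<kappa>) * R\<^sup>2 \<le> P"
  proof -
    have "P = R\<^sup>2 + (\<Sum>i\<in>I. r i * \<xi> i)"
      by (simp add: P_def R2 distrib_left sum.distrib flip: power2_eq_square)
    then show ?thesis using angle by (simp add: R_def algebra_simps)
  qed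
  \<comment> \<open>If \<open>G\<close> were 0, then \<open>P\<close> would vanish, against its
    positive lower bound. Hence \<open>G\<close> may serve as a denominator in the step
    size.\<close>
  have G: "0 < G"
  proof (rule ccontr)
    assume "\<not> 0 < G"
    then have "\<forall>i\<in>I. r i + \<xi> i = 0" using G0 L2_set_eq_0_iff[OF I(1)] unfolding G_def by force
    then have "P = 0" by (simp add: P_def)
    then show False using P R \<kappa> by (simp add: mult_le_0_iff)
  qed
  \<comment> \<open>The first-order gain will be at least \<open>0.8 * q * \<tau>\<close> and the
    second-order loss at most \<open>\<tau>\<^sup>2\<close>; this \<open>\<tau>\<close> maximizes
    the difference. Being at most \<open>0.4\<close>, it also keeps relative changes in the range of
    \<open>ln_one_plus_ge_quadratic\<close>.\<close>
  define \<tau> where "\<tau> = 0.4 * q"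
  have \<tau>: "0 < \<tau>" "\<tau> \<le> 0.4" using q by (auto simp: \<tau>_def)
  define \<alpha> where "\<alpha> = \<tau> * w j / G"
  have \<alpha>: "0 < \<alpha>" using \<tau> wj G by (simp add: \<alpha>_def)
  \<comment> \<open>Because \<open>w j\<close> is minimal, the varying denominators disappear.
    Summed over \<open>i\<close>, for \<open>u\<close> and \<open>v\<close> together, these bounds
    give \<open>\<tau>\<^sup>2\<close> by \<open>G2\<close>.\<close>
  have sq_bound: "(\<alpha> * a i / w i)\<^sup>2 \<le> (\<tau> / G)\<^sup>2 * (a i)\<^sup>2" if "i \<in> I" for a i
  proof -
    have "w j / w i \<le> 1" "0 \<le> w j / w i" using j(2)[OF that] pos[OF that] wj by auto
    then have "(w j / w i)\<^sup>2 \<le> 1" by (simp add: power_le_one)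
    then have "((\<tau> / G)\<^sup>2 * (a i)\<^sup>2) * (w j / w i)\<^sup>2 \<le> ((\<tau> / G)\<^sup>2 * (a i)\<^sup>2) * 1"
      by (intro mult_left_mono) auto
    then show ?thesis by (simp add: \<alpha>_def power_mult_distrib power_divide mult_ac)
  qed
  have ratio: "\<bar>\<alpha> * a i / w i\<bar> \<le> 0.4" if "i \<in> I" "(\<Sum>i\<in>I. (a i)\<^sup>2) \<le> G\<^sup>2" for a i
  proof -
    have "(a i)\<^sup>2 \<le> (\<Sum>i\<in>I. (a i)\<^sup>2)" using I that(1) by (intro member_le_sum) auto
    then have "(\<tau> / G)\<^sup>2 * (a i)\<^sup>2 \<le> (\<tau> / G)\<^sup>2 * G\<^sup>2" using that(2) by (intro mult_left_mono) auto
    also have "\<dots> = \<tau>\<^sup>2" using G by (simp add: power_divide)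
    finally have "(\<alpha> * a i / w i)\<^sup>2 \<le> \<tau>\<^sup>2" using sq_bound[OF that(1), of a] by linarith
    then have "\<bar>\<alpha> * a i / w i\<bar> \<le> \<bar>\<tau>\<bar>" by (simp only: abs_le_square_iff)
    then show ?thesis using \<tau> by linarith
  qed
  have u: "\<bar>\<alpha> * u i / w i\<bar> \<le> 0.4" and v: "\<bar>\<alpha> * v i / w i\<bar> \<le> 0.4" if "i \<in> I" for i
    using ratio[OF that, of u] ratio[OF that, of v] by (auto simp: G2 sum_nonneg)
  have factor: "w i + \<alpha> * a i = w i * (1 + \<alpha> * a i / w i)" if "i \<in> I" for a i
    using pos[OF that] by (simp add: distrib_left)
  have one_plus: "0 < 1 + \<alpha> * u i / w i" "0 < 1 + \<alpha> * v i / w i" if "i \<in> I" for i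
    using u[OF that] v[OF that] by linarith+
  have posu: "0 < w i + \<alpha> * u i" and posv: "0 < w i + \<alpha> * v i" if "i \<in> I" for i
    unfolding factor[OF that] using pos[OF that] one_plus[OF that] by simp_all

  define S' where "S' = (\<Sum>i\<in>I. (w i + \<alpha> * u i) * (w i + \<alpha> * v i))"
  have S'0: "0 < S'" unfolding S'_def using I posu posv by (intro sum_pos) auto
  have S': "S' = S + \<alpha> * (\<Sum>i\<in>I. w i * (r i + \<xi> i))"
  proof -
    have "S' = (\<Sum>i\<in>I. (w i)\<^sup>2 + \<alpha> * (w i * (r i + \<xi> i)) + \<alpha>\<^sup>2 * (u i * v i))"
      unfolding S'_def
      by (intro sum.cong refl, subst uv[symmetric]) (simp_all add: power2_eq_square algebra_simps)
    then show ?thesis using orth by (simp add: sum.distrib S_def sum_distrib_left[symmetric])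
  qed
  \<comment> \<open>This is the tangent to \<open>ln\<close> at \<open>S\<close>; the choice of
    \<open>\<mu>\<close> turns the factor \<open>N / S\<close> into
    \<open>1 / \<mu>\<close>.\<close>
  have gap: "N * ln S' \<le> N * ln S + \<alpha> / \<mu> * (\<Sum>i\<in>I. w i * (r i + \<xi> i))"
  proof -
    have "ln (S' / S) \<le> S' / S - 1" using S S'0 by (intro ln_le_minus_one) auto
    then have "ln S' - ln S \<le> \<alpha> * (\<Sum>i\<in>I. w i * (r i + \<xi> i)) / S"
      using S S'0 by (simp add: ln_div S' field_simps)
    from mult_left_mono[OF this, of N]
    have "N * (ln S' - ln S) \<le> N / S * (\<alpha> * (\<Sum>i\<in>I. w i * (r i + \<xi> i)))"
      using N by simp
    then show ?thesis by (simp add: NS algebra_simps)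
  qed
  have barrier: "(\<Sum>i\<in>I. ln ((w i)\<^sup>2)) + \<alpha> * (\<Sum>i\<in>I. (r i + \<xi> i) / w i) - \<tau>\<^sup>2
      \<le> (\<Sum>i\<in>I. ln ((w i + \<alpha> * u i) * (w i + \<alpha> * v i)))"
  proof -
    have "(\<Sum>i\<in>I. ln ((w i)\<^sup>2) + \<alpha> * ((r i + \<xi> i) / w i) - (\<tau> / G)\<^sup>2 * ((u i)\<^sup>2 + (v i)\<^sup>2))
        \<le> (\<Sum>i\<in>I. ln ((w i + \<alpha> * u i) * (w i + \<alpha> * v i)))"
    proof (rule sum_mono)
      fix i assume i: "i \<in> I"
      let ?a = "\<alpha> * u i / w i" and ?b = "\<alpha> * v i / w i"
      have "(w i + \<alpha> * u i) * (w i + \<alpha> * v i) = (w i)\<^sup>2 * ((1 + ?a) * (1 + ?b))"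
        unfolding factor[OF i] by (simp add: power2_eq_square)
      then have "ln ((w i + \<alpha> * u i) * (w i + \<alpha> * v i)) = ln ((w i)\<^sup>2) + (ln (1 + ?a) + ln (1 + ?b))"
        using pos[OF i] one_plus[OF i] by (simp add: ln_mult_pos)
      moreover have "?a - ?a\<^sup>2 \<le> ln (1 + ?a)" "?b - ?b\<^sup>2 \<le> ln (1 + ?b)"
        using u[OF i] v[OF i] by (intro ln_one_plus_ge_quadratic; linarith)+
      moreover have "?a\<^sup>2 \<le> (\<tau> / G)\<^sup>2 * (u i)\<^sup>2" "?b\<^sup>2 \<le> (\<tau> / G)\<^sup>2 * (v i)\<^sup>2"
        using sq_bound[OF i] by blast+
      moreover have "?a + ?b = \<alpha> * ((r i + \<xi> i) / w i)"
        by (simp add: uv[OF i, symmetric] add_divide_distrib distrib_left)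
      ultimately show "ln ((w i)\<^sup>2) + \<alpha> * ((r i + \<xi> i) / w i) - (\<tau> / G)\<^sup>2 * ((u i)\<^sup>2 + (v i)\<^sup>2)
          \<le> ln ((w i + \<alpha> * u i) * (w i + \<alpha> * v i))"
        unfolding distrib_left[of "(\<tau> / G)\<^sup>2"] by linarith
    qed
    also have "(\<Sum>i\<in>I. ln ((w i)\<^sup>2) + \<alpha> * ((r i + \<xi> i) / w i) - (\<tau> / G)\<^sup>2 * ((u i)\<^sup>2 + (v i)\<^sup>2))
        = (\<Sum>i\<in>I. ln ((w i)\<^sup>2)) + \<alpha> * (\<Sum>i\<in>I. (r i + \<xi> i) / w i) - (\<tau> / G)\<^sup>2 * G\<^sup>2"
      unfolding G2 by (simp only: sum.distrib sum_subtractf flip: sum_distrib_left)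
    also have "(\<tau> / G)\<^sup>2 * G\<^sup>2 = \<tau>\<^sup>2" using G by (simp add: power_divide)
    finally show ?thesis by simp
  qed
  \<comment> \<open>The linear terms of gap and barrier combine through
    \<open>r i = \<mu> / w i - w i\<close> into the inner product \<open>P\<close>.\<close>
  have slope: "\<alpha> / \<mu> * (\<Sum>i\<in>I. w i * (r i + \<xi> i)) - \<alpha> * (\<Sum>i\<in>I. (r i + \<xi> i) / w i) = - (\<alpha> / \<mu> * P)"
  proof -
    have "(\<Sum>i\<in>I. w i * (r i + \<xi> i)) - \<mu> * (\<Sum>i\<in>I. (r i + \<xi> i) / w i) = - P"
      unfolding P_def sum_distrib_left sum_subtractf[symmetric] sum_negf[symmetric]
    proof (intro sum.cong refl)
      fix i assume "i \<in> I"
      then have "\<mu> / w i * (r i + \<xi> i) = (r i + w i) * (r i + \<xi> i)" using r by simp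
      then show "w i * (r i + \<xi> i) - \<mu> * ((r i + \<xi> i) / w i) = - (r i * (r i + \<xi> i))"
        by (simp add: algebra_simps add_divide_distrib)
    qed
    then have "\<alpha> / \<mu> * ((\<Sum>i\<in>I. w i * (r i + \<xi> i)) - \<mu> * (\<Sum>i\<in>I. (r i + \<xi> i) / w i)) = - (\<alpha> / \<mu> * P)"
      by simp
    then show ?thesis using mu0 by (simp add: right_diff_distrib)
  qed
  have decrease: "0.32 * q\<^sup>2 \<le> \<alpha> / \<mu> * P"
  proof -
    \<comment> \<open>The factor \<open>q\<close> collects one \<open>1 - \<kappa>\<close> from the
      angle condition in \<open>P\<close> and one from the norm bound \<open>GR\<close>.\<close>
    have "(1 - \<kappa>) * R * ((1 - \<kappa>) * G) \<le> (1 - \<kappa>) * R * R"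
      using GR \<kappa> R by (intro mult_left_mono) auto
    then have "q * R * G \<le> P" using P by (simp add: q_def power2_eq_square mult_ac)
    then have "q * R \<le> P / G" using G by (simp add: field_simps)
    have "0.8 * q \<le> q * (w j * R / \<mu>)"
      using mult_left_mono[OF R_lower, of q] q mu0 by (simp add: field_simps)
    also have "\<dots> = w j / \<mu> * (q * R)" by simp
    also have "\<dots> \<le> w j / \<mu> * (P / G)"
      using \<open>q * R \<le> P / G\<close> wj mu0 by (intro mult_left_mono) auto
    finally have "\<tau> * (0.8 * q) \<le> \<tau> * (w j / \<mu> * (P / G))" using \<tau> by (intro mult_left_mono) auto
    then show ?thesis by (simp add: \<tau>_def \<alpha>_def power2_eq_square mult_ac)
  qed
  have "N * ln S' - (\<Sum>i\<in>I. ln ((w i + \<alpha> * u i) * (w i + \<alpha> * v i)))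
      \<le> N * ln S - (\<Sum>i\<in>I. ln ((w i)\<^sup>2)) - 0.32 * q\<^sup>2 + \<tau>\<^sup>2"
    using gap barrier slope decrease by linarith
  \<comment> \<open>Here \<open>\<tau>\<^sup>2 = 0.16 * q\<^sup>2\<close>, so a decrease of
    \<open>0.16 * q\<^sup>2\<close> remains, slightly more than required.\<close>
  also have "- 0.32 * q\<^sup>2 + \<tau>\<^sup>2 \<le> - 0.15 * q\<^sup>2"
    by (simp add: \<tau>_def power_mult_distrib power2_eq_square)
  then have "N * ln S - (\<Sum>i\<in>I. ln ((w i)\<^sup>2)) - 0.32 * q\<^sup>2 + \<tau>\<^sup>2
      \<le> N * ln S - (\<Sum>i\<in>I. ln ((w i)\<^sup>2)) - 0.15 * q\<^sup>2" by simp
  also have "q\<^sup>2 = (1 - \<kappa>) ^ 4" by (simp add: q_def flip: power_mult)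
  finally show ?thesis
    using that[OF \<alpha> posu posv] unfolding N_def S_def S'_def by blast
qed

section \<open>Diagonal scalings, full row rank and normal equations\<close>

lemma mat_diag_mult_vec:
  assumes "v \<in> carrier_vec n"
  shows "mat_diag n f *\<^sub>v v = vec n (\<lambda>i. f i * v $ i)"
proof (rule eq_vecI)
  fix i assume "i < dim_vec (vec n (\<lambda>i. f i * v $ i))"
  then have i: "i < n" by simp
  have "(mat_diag n f *\<^sub>v v) $ i = (\<Sum>j\<in>{0..<n}. (if i = j then f j else 0) * v $ j)"
    using i assms by (simp add: mat_diag_def mult_mat_vec_def scalar_prod_def)
  also have "\<dots> = (\<Sum>j\<in>{0..<n}. if j = i then f i * v $ i else 0)"
    by (intro sum.cong) auto
  finally show "(mat_diag n f *\<^sub>v v) $ i = vec n (\<lambda>i. f i * v $ i) $ i"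
    using i by simp
qed (simp add: mat_diag_def)

lemma transpose_mat_diag: "transpose_mat (mat_diag n f) = mat_diag n f"
  by (intro eq_matI) (auto simp: mat_diag_def)

lemma real_vec_self_scalar_prod_eq_0:
  fixes v :: "real vec"
  assumes "v \<in> carrier_vec n" "v \<bullet> v = 0"
  shows "v = 0\<^sub>v n"
  using conjugate_square_eq_0_vec[OF assms(1)] assms(2) by simp

text \<open>A maximal independent set of columns has \<open>m\<close> elements and therefore spans
  the whole space. A vector orthogonal to all columns is then orthogonal to itself.\<close>

lemma full_row_rank_transpose_kernel:
  fixes A :: "real mat"
  assumes A: "A \<in> carrier_mat m n" and rank: "vec_space.rank m A = m"
    and y: "y \<in> carrier_vec m" and ker: "transpose_mat A *\<^sub>v y = 0\<^sub>v n"
  shows "y = 0\<^sub>v m"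
proof -
  interpret vec_space "TYPE(real)" m .
  have cols: "set (cols A) \<subseteq> carrier_vec m" using A cols_dim by blast
  have "lin_indpt {}" by (rule finite_lin_indpt2) auto
  then obtain S where S: "finite S" "maximal S (\<lambda>T. T \<subseteq> set (cols A) \<and> lin_indpt T)"
    using maximal_exists_superset[of "set (cols A)" "\<lambda>T. T \<subseteq> set (cols A) \<and> lin_indpt T" "{}"]
    by auto
  have "card S = m" using rank_card_indpt[OF A S(2)] rank by simp
  moreover have sub: "S \<subseteq> set (cols A)" and "lin_indpt S" using S(2) by (auto simp: maximal_def)
  ultimately have "basis S"
    using S(1) cols by (intro dim_li_is_basis) (auto simp: dim_is_n)
  then have span: "span S = carrier_vec m" by (auto simp: basis_def)
  have "y \<bullet> a = 0" if a: "a \<in> set (cols A)" for a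
  proof -
    obtain j where j: "j < n" "a = col A j"
      using a A by (auto simp: cols_def)
    have "y \<bullet> a = (transpose_mat A *\<^sub>v y) $ j"
      using A y j by (simp add: comm_scalar_prod[of _ m])
    then show ?thesis using ker j by simp
  qed
  then have "y \<in> orthogonal_complement S"
    using y sub by (auto simp: orthogonal_complement_def)
  then have "y \<in> orthogonal_complement (span S)"
    using sub cols by (subst in_orthogonal_complement_span) auto
  then have "y \<bullet> y = 0" unfolding span using y by (auto simp: orthogonal_complement_def)
  with y show ?thesis by (rule real_vec_self_scalar_prod_eq_0)
qed

text \<open>Pairing the product of \<open>M\<close> and its transpose with \<open>y\<close> on both
  sides gives the squared norm of \<open>transpose_mat M *\<^sub>v y\<close>. Injectivity of the
  transpose thus makes the product nonsingular.\<close>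

lemma gram_system_solvable:
  fixes M :: "real mat"
  assumes M: "M \<in> carrier_mat m n" and g: "g \<in> carrier_vec m"
    and inj: "\<And>y. y \<in> carrier_vec m \<Longrightarrow> transpose_mat M *\<^sub>v y = 0\<^sub>v n \<Longrightarrow> y = 0\<^sub>v m"
  obtains y where "y \<in> carrier_vec m" "M *\<^sub>v (transpose_mat M *\<^sub>v y) = g"
proof -
  let ?N = "M * transpose_mat M"
  have Mt: "transpose_mat M \<in> carrier_mat n m" using M by simp
  have N: "?N \<in> carrier_mat m m" using M by simp
  have N_mult: "?N *\<^sub>v y = M *\<^sub>v (transpose_mat M *\<^sub>v y)" if "y \<in> carrier_vec m" for y
    using M Mt that by (rule assoc_mult_mat_vec)
  have "det ?N \<noteq> 0"
  proof
    assume "det ?N = 0"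
    then obtain y where y: "y \<in> carrier_vec m" "y \<noteq> 0\<^sub>v m" "?N *\<^sub>v y = 0\<^sub>v m"
      using det_0_iff_vec_prod_zero_field[OF N] by blast
    have My: "transpose_mat M *\<^sub>v y \<in> carrier_vec n" using Mt y(1) by simp
    have "(transpose_mat M *\<^sub>v y) \<bullet> (transpose_mat M *\<^sub>v y) = y \<bullet> (?N *\<^sub>v y)"
      using transpose_vec_mult_scalar[OF M My y(1)] N_mult[OF y(1)] by simp
    then have "(transpose_mat M *\<^sub>v y) \<bullet> (transpose_mat M *\<^sub>v y) = 0" using y by simp
    then have "transpose_mat M *\<^sub>v y = 0\<^sub>v n" by (rule real_vec_self_scalar_prod_eq_0[OF My])
    then show False using inj y by blast
  qed
  from det_non_zero_imp_unit[OF N this, of "()"]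
  obtain B where B: "B \<in> carrier_mat m m" "?N * B = 1\<^sub>m m"
    by (auto simp: Units_def ring_mat_def)
  have Bg: "B *\<^sub>v g \<in> carrier_vec m" using B g by simp
  have "?N *\<^sub>v (B *\<^sub>v g) = g"
    using assoc_mult_mat_vec[OF N B(1) g] B(2) g by simp
  then show thesis using that[OF Bg] N_mult[OF Bg] by simp
qed

section \<open>The Newton system at strictly feasible iterates\<close>

lemma scalar_prod_eq_sum_lessThan: "v \<in> carrier_vec n \<Longrightarrow> u \<bullet> v = (\<Sum>i<n. u $ i * v $ i)"
  by (simp add: scalar_prod_def atLeast0LessThan)

lemma strictly_feasibleD:
  assumes "(x, y, z) \<in> strictly_feasible A b c" "A \<in> carrier_mat m n"
  shows "x \<in> carrier_vec n" "y \<in> carrier_vec m" "z \<in> carrier_vec n"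
    "A *\<^sub>v x = b" "transpose_mat A *\<^sub>v y + z = c"
    "\<And>i. i < n \<Longrightarrow> 0 < x $ i" "\<And>i. i < n \<Longrightarrow> 0 < z $ i"
  using assms by (auto simp: strictly_feasible_def positive_vec_def)

lemma centering_rhs_carrier:
  "x \<in> carrier_vec n \<Longrightarrow> centering_rhs \<mu> x z \<in> carrier_vec n"
  by (simp add: centering_rhs_def scaling_W_def scaling_W_inv_def ones_def mat_diag_mult_vec)

lemma centering_rhs_nth:
  assumes "x \<in> carrier_vec n" "i < n"
  shows "centering_rhs \<mu> x z $ i = \<mu> / sqrt (x $ i * z $ i) - sqrt (x $ i * z $ i)"
  using assms
  by (simp add: centering_rhs_def scaling_W_def scaling_W_inv_def ones_def mat_diag_mult_vec)

text \<open>Feasibility makes the first two Newton equations homogeneous, from which the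
  orthogonality of \<open>du\<close> and \<open>dv\<close> is later derived.\<close>

lemma feasible_newton_rhs:
  assumes A: "A \<in> carrier_mat m n" and feas: "(x, y, z) \<in> strictly_feasible A b c"
  shows "b - A *\<^sub>v x = 0\<^sub>v m"
    "scaling_D x z *\<^sub>v (c - transpose_mat A *\<^sub>v y - z) = 0\<^sub>v n"
proof -
  note f = strictly_feasibleD[OF feas A]
  show "b - A *\<^sub>v x = 0\<^sub>v m" using f(4) A f(1) by (auto intro!: eq_vecI)
  have "c - transpose_mat A *\<^sub>v y - z = 0\<^sub>v n"
    unfolding f(5)[symmetric] using A f by (intro eq_vecI) auto
  then show "scaling_D x z *\<^sub>v (c - transpose_mat A *\<^sub>v y - z) = 0\<^sub>v n"
    using f(1) by (auto simp: scaling_D_def mat_diag_mult_vec intro!: eq_vecI)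
qed

text \<open>The exact Newton direction serves as witness: with residual zero both admissibility
  conditions hold trivially.\<close>

lemma search_direction_exists:
  assumes A: "A \<in> carrier_mat m n" and rank: "vec_space.rank m A = m"
    and feas: "(x, y, z) \<in> strictly_feasible A b c" and \<kappa>: "0 \<le> \<kappa>"
  shows "\<exists>d. search_direction A b c \<nu> \<kappa> (x, y, z) d"
proof -
  note f = strictly_feasibleD[OF feas A]
  define D where "D = scaling_D x z"
  have D: "D \<in> carrier_mat n n" using f(1) by (simp add: D_def scaling_D_def)
  have Dt: "transpose_mat D = D" by (simp add: D_def scaling_D_def transpose_mat_diag)
  define M where "M = A * D"
  have M: "M \<in> carrier_mat m n" using A D by (simp add: M_def)
  have Mt: "transpose_mat M = D * transpose_mat A"
    using A D by (simp add: M_def transpose_mult Dt)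
  define r where "r = centering_rhs (gap_param \<nu> x z) x z"
  have r: "r \<in> carrier_vec n" using f(1) by (simp add: r_def centering_rhs_carrier)
  \<comment> \<open>The positive diagonal of \<open>D\<close> cancels, which leaves the kernel of
    the transpose of \<open>A\<close>.\<close>
  have inj: "y' = 0\<^sub>v m" if y': "y' \<in> carrier_vec m" "transpose_mat M *\<^sub>v y' = 0\<^sub>v n" for y'
  proof -
    have Ay: "transpose_mat A *\<^sub>v y' \<in> carrier_vec n" using A y' by simp
    have DAy: "D *\<^sub>v (transpose_mat A *\<^sub>v y') = 0\<^sub>v n"
      using y' A D assoc_mult_mat_vec[of D n n "transpose_mat A" m y'] by (simp add: Mt)
    have "transpose_mat A *\<^sub>v y' = 0\<^sub>v n"
    proof (rule eq_vecI)
      fix i assume "i < dim_vec (0\<^sub>v n)"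
      then have i: "i < n" by simp
      have "sqrt (x $ i) / sqrt (z $ i) * (transpose_mat A *\<^sub>v y') $ i
          = (D *\<^sub>v (transpose_mat A *\<^sub>v y')) $ i"
        using f(1) i Ay by (simp add: D_def scaling_D_def mat_diag_mult_vec)
      also have "\<dots> = 0" using DAy i by simp
      finally show "(transpose_mat A *\<^sub>v y') $ i = 0\<^sub>v n $ i"
        using f(6,7)[OF i] i by simp
    qed (use A in simp)
    then show ?thesis using full_row_rank_transpose_kernel[OF A rank y'(1)] by blast
  qed
  \<comment> \<open>Solving these normal equations puts \<open>r + t\<close> into the kernel of
    \<open>M\<close>, so \<open>r\<close> splits into the kernel part \<open>r + t\<close> and the
    row-space part \<open>- t\<close>.\<close>
  have "- (M *\<^sub>v r) \<in> carrier_vec m" using M r by simp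
  then obtain dy
    where dy: "dy \<in> carrier_vec m" "M *\<^sub>v (transpose_mat M *\<^sub>v dy) = - (M *\<^sub>v r)"
    by (rule gram_system_solvable[OF M _ inj])
  define t where "t = transpose_mat M *\<^sub>v dy"
  have t: "t \<in> carrier_vec n" using M dy by (simp add: t_def)
  have "M *\<^sub>v (r + t) = 0\<^sub>v m"
    using dy(2) M r t by (simp add: mult_add_distrib_mat_vec t_def[symmetric])
  moreover have "t + - t = 0\<^sub>v n" "r + t + - t = r + 0\<^sub>v n" using r t by (auto intro!: eq_vecI)
  moreover have "dim_row A = m" "dim_col A = n" using A by auto
  moreover have "r + t \<in> carrier_vec n" "- t \<in> carrier_vec n" using r t by auto
  ultimately have sol:
    "inexact_newton_solution A b c (gap_param \<nu> x z) (x, y, z) (0\<^sub>v n) (r + t) dy (- t)"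
    unfolding inexact_newton_solution_def split D_def[symmetric] M_def[symmetric] Mt[symmetric]
      t_def[symmetric] r_def[symmetric] feasible_newton_rhs[OF A feas, folded D_def]
    using dy(1) by (metis zero_carrier_vec)
  have "admissible_residual \<kappa> r (0\<^sub>v n) (r + t) (- t)"
    using \<kappa> r by (simp add: admissible_residual_def euclidean_norm_def L2_set_0')
  then show ?thesis
    using sol unfolding search_direction_def r_def by (auto intro!: exI)
qed

text \<open>The scaled step \<open>du\<close> lies in the kernel of \<open>M\<close> and
  \<open>dv\<close> in the range of its transpose, hence they are orthogonal. Undoing the scaling
  gives the homogeneous equations for \<open>dx\<close>, \<open>dy\<close> and
  \<open>dz\<close>.\<close>

lemma search_directionE:
  assumes A: "A \<in> carrier_mat m n" and feas: "(x, y, z) \<in> strictly_feasible A b c"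
    and dir: "search_direction A b c \<nu> \<kappa> (x, y, z) (dx, dy, dz)"
  obtains \<xi> du dv where
    "\<xi> \<in> carrier_vec n" "du \<in> carrier_vec n" "dy \<in> carrier_vec m" "dv \<in> carrier_vec n"
    "A *\<^sub>v dx = 0\<^sub>v m" "transpose_mat A *\<^sub>v dy + dz = 0\<^sub>v n" "(\<Sum>i<n. du $ i * dv $ i) = 0"
    "du + dv = centering_rhs (gap_param \<nu> x z) x z + \<xi>"
    "admissible_residual \<kappa> (centering_rhs (gap_param \<nu> x z) x z) \<xi> du dv"
    "dx = vec n (\<lambda>i. sqrt (x $ i) / sqrt (z $ i) * du $ i)"
    "dz = vec n (\<lambda>i. sqrt (z $ i) / sqrt (x $ i) * dv $ i)"
proof -
  note f = strictly_feasibleD[OF feas A]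
  define D where "D = scaling_D x z"
  have D: "D \<in> carrier_mat n n" using f(1) by (simp add: D_def scaling_D_def)
  have Dt: "transpose_mat D = D" by (simp add: D_def scaling_D_def transpose_mat_diag)
  define M where "M = A * D"
  have M: "M \<in> carrier_mat m n" using A D by (simp add: M_def)
  have Mt: "transpose_mat M = D * transpose_mat A"
    using A D by (simp add: M_def transpose_mult Dt)
  obtain \<xi> du dv where
    sol: "inexact_newton_solution A b c (gap_param \<nu> x z) (x, y, z) \<xi> du dy dv" and
    adm: "admissible_residual \<kappa> (centering_rhs (gap_param \<nu> x z) x z) \<xi> du dv" and
    dx: "dx = D *\<^sub>v du" and dz: "dz = scaling_D_inv x z *\<^sub>v dv"
    using dir by (auto simp: search_direction_def D_def)
  have car: "\<xi> \<in> carrier_vec n" "du \<in> carrier_vec n" "dy \<in> carrier_vec m" "dv \<in> carrier_vec n"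
    and primal: "M *\<^sub>v du = 0\<^sub>v m" and dual: "transpose_mat M *\<^sub>v dy + dv = 0\<^sub>v n"
    and uv: "du + dv = centering_rhs (gap_param \<nu> x z) x z + \<xi>"
    using sol A
    unfolding inexact_newton_solution_def split D_def[symmetric] M_def[symmetric] Mt[symmetric]
      feasible_newton_rhs[OF A feas, folded D_def]
    by blast+
  have Mdy: "transpose_mat M *\<^sub>v dy \<in> carrier_vec n" using M car by simp
  have Ady: "transpose_mat A *\<^sub>v dy \<in> carrier_vec n" using A car by simp
  have Mdy_eq: "transpose_mat M *\<^sub>v dy = D *\<^sub>v (transpose_mat A *\<^sub>v dy)"
    unfolding Mt using A D car by (intro assoc_mult_mat_vec) auto
  have dx': "dx = vec n (\<lambda>i. sqrt (x $ i) / sqrt (z $ i) * du $ i)"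
    using f(1) car(2) by (simp add: dx D_def scaling_D_def mat_diag_mult_vec)
  have dz': "dz = vec n (\<lambda>i. sqrt (z $ i) / sqrt (x $ i) * dv $ i)"
    using f(1) car(4) by (simp add: dz scaling_D_inv_def mat_diag_mult_vec)
  have "A *\<^sub>v dx = 0\<^sub>v m"
    using primal A D car(2) by (simp add: dx M_def)
  moreover have "transpose_mat A *\<^sub>v dy + dz = 0\<^sub>v n"
  proof (rule eq_vecI)
    fix i assume "i < dim_vec (0\<^sub>v n)"
    then have i: "i < n" by simp
    \<comment> \<open>Dividing this coordinate of the dual equation by the positive scaling entry
      turns \<open>dv\<close> into \<open>dz\<close>.\<close>
    have "sqrt (x $ i) / sqrt (z $ i) * (transpose_mat A *\<^sub>v dy) $ i + dv $ i
        = (transpose_mat M *\<^sub>v dy + dv) $ i"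
      using f(1) i Ady Mdy car
      by (simp add: Mdy_eq D_def scaling_D_def mat_diag_mult_vec del: index_mult_mat_vec)
    also have "\<dots> = 0" using dual i by simp
    finally show "(transpose_mat A *\<^sub>v dy + dz) $ i = 0\<^sub>v n $ i"
      using f(6,7)[OF i] i Ady
      by (simp add: dz' field_simps del: index_mult_mat_vec)
  qed (simp add: dz')
  moreover have "(\<Sum>i<n. du $ i * dv $ i) = 0"
  proof -
    have "(transpose_mat M *\<^sub>v dy + dv) \<bullet> du = dy \<bullet> (M *\<^sub>v du) + dv \<bullet> du"
      using add_scalar_prod_distrib[OF Mdy car(4,2)] transpose_vec_mult_scalar[OF M car(2,3)] by simp
    then have "dv \<bullet> du = 0" using dual primal car by simp
    then show ?thesis using car by (simp add: scalar_prod_eq_sum_lessThan[of _ n] mult.commute)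
  qed
  ultimately show thesis using that car uv adm dx' dz' by blast
qed

text \<open>The direction solves the homogeneous equations, so the equality constraints survive any
  step size; only positivity constrains \<open>\<alpha>\<close>.\<close>

lemma strictly_feasible_move:
  assumes A: "A \<in> carrier_mat m n" and feas: "(x, y, z) \<in> strictly_feasible A b c"
    and dir: "search_direction A b c \<nu> \<kappa> (x, y, z) (dx, dy, dz)"
    and pos: "positive_vec (x + \<alpha> \<cdot>\<^sub>v dx)" "positive_vec (z + \<alpha> \<cdot>\<^sub>v dz)"
  shows "(x + \<alpha> \<cdot>\<^sub>v dx, y + \<alpha> \<cdot>\<^sub>v dy, z + \<alpha> \<cdot>\<^sub>v dz) \<in> strictly_feasible A b c"
proof -
  note f = strictly_feasibleD[OF feas A]
  have d: "dy \<in> carrier_vec m" "A *\<^sub>v dx = 0\<^sub>v m" "transpose_mat A *\<^sub>v dy + dz = 0\<^sub>v n"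
    and car: "dx \<in> carrier_vec n" "dz \<in> carrier_vec n"
    by (rule search_directionE[OF A feas dir]; simp)+
  have At: "transpose_mat A \<in> carrier_mat n m" using A by simp
  have "A *\<^sub>v (x + \<alpha> \<cdot>\<^sub>v dx) = b"
    using A f car d(2) by (auto simp: mult_add_distrib_mat_vec mult_mat_vec)
  moreover have "transpose_mat A *\<^sub>v (y + \<alpha> \<cdot>\<^sub>v dy) + (z + \<alpha> \<cdot>\<^sub>v dz) = c"
  proof -
    have Ay: "transpose_mat A *\<^sub>v y \<in> carrier_vec n" "transpose_mat A *\<^sub>v dy \<in> carrier_vec n"
      using At f d by simp_all
    have "transpose_mat A *\<^sub>v (y + \<alpha> \<cdot>\<^sub>v dy) + (z + \<alpha> \<cdot>\<^sub>v dz)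
        = (transpose_mat A *\<^sub>v y + \<alpha> \<cdot>\<^sub>v (transpose_mat A *\<^sub>v dy)) + (z + \<alpha> \<cdot>\<^sub>v dz)"
      using At f d by (simp add: mult_add_distrib_mat_vec mult_mat_vec)
    also have "\<dots> = (transpose_mat A *\<^sub>v y + z) + \<alpha> \<cdot>\<^sub>v (transpose_mat A *\<^sub>v dy + dz)"
      using Ay f(3) car carrier_vecD[OF Ay(2)] by (intro eq_vecI) (auto simp: algebra_simps simp del: index_mult_mat_vec)
    also have "\<dots> = c" using f(5) d(3) Ay f(3) by auto
    finally show ?thesis .
  qed
  ultimately show ?thesis
    using A f car d(1) pos by (auto simp: strictly_feasible_def)
qed

text \<open>The moved points are the scaled points \<open>w + \<alpha> * du\<close> and
  \<open>w + \<alpha> * dv\<close> multiplied by inverse scalings. These cancel in each product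
  \<open>x' $ i * z' $ i\<close>, and the potential depends on such products alone, so
  \<open>scaled_potential_reduction\<close> applies.\<close>

lemma acceptable_step_size_exists:
  assumes A: "A \<in> carrier_mat m n" and feas: "(x, y, z) \<in> strictly_feasible A b c"
    and dir: "search_direction A b c \<nu> \<kappa> (x, y, z) d"
    and n: "0 < n" and \<nu>: "sqrt (real n) \<le> \<nu>" and \<kappa>: "0 \<le> \<kappa>" "\<kappa> < 1"
  shows "\<exists>\<alpha>>0. acceptable_move \<nu> \<kappa> (x, y, z) (move \<alpha> d (x, y, z))"
proof -
  note f = strictly_feasibleD[OF feas A]
  obtain dx dy dz where d: "d = (dx, dy, dz)" by (cases d)
  define \<mu> where "\<mu> = gap_param \<nu> x z"
  define r where "r = centering_rhs \<mu> x z"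
  obtain \<xi> du dv where
    car: "\<xi> \<in> carrier_vec n" "du \<in> carrier_vec n" "dv \<in> carrier_vec n"
    and orth: "(\<Sum>i<n. du $ i * dv $ i) = 0"
    and uv: "du + dv = r + \<xi>" and adm: "admissible_residual \<kappa> r \<xi> du dv"
    and dx: "dx = vec n (\<lambda>i. sqrt (x $ i) / sqrt (z $ i) * du $ i)"
    and dz: "dz = vec n (\<lambda>i. sqrt (z $ i) / sqrt (x $ i) * dv $ i)"
    by (rule search_directionE[OF A feas dir[unfolded d]]) (auto simp: r_def \<mu>_def)
  define w where "w i = sqrt (x $ i * z $ i)" for i
  have w: "0 < w i" "(w i)\<^sup>2 = x $ i * z $ i" if "i < n" for i
    using f(6,7)[OF that] by (auto simp: w_def)
  have norm: "euclidean_norm v = L2_set (\<lambda>i. v $ i) {..<n}" if "v \<in> carrier_vec n" for v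
    using that by (simp add: euclidean_norm_def)
  have r: "r \<in> carrier_vec n" "\<And>i. i < n \<Longrightarrow> r $ i = \<mu> / w i - w i"
    using f(1) by (simp_all add: r_def centering_rhs_carrier centering_rhs_nth w_def)
  have gap: "x \<bullet> z = (\<Sum>i<n. (w i)\<^sup>2)"
    unfolding scalar_prod_eq_sum_lessThan[OF f(3)] using w by (intro sum.cong) auto
  have entry: "du $ i + dv $ i = r $ i + \<xi> $ i" if "i < n" for i
    using arg_cong[OF uv, of "\<lambda>v. v $ i"] that car r(1) by simp
  have angle: "- (\<Sum>i<n. r $ i * \<xi> $ i) \<le> \<kappa> * (L2_set (\<lambda>i. r $ i) {..<n})\<^sup>2"
    using adm car r(1) by (simp add: admissible_residual_def norm scalar_prod_eq_sum_lessThan)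
  have "L2_set (\<lambda>i. \<xi> $ i) {..<n}
      \<le> \<kappa> * min (L2_set (\<lambda>i. du $ i) {..<n}) (L2_set (\<lambda>i. dv $ i) {..<n})"
    using adm car by (simp add: admissible_residual_def norm)
  also have "\<dots> \<le> \<kappa> * L2_set (\<lambda>i. du $ i) {..<n}" using \<kappa> by (intro mult_left_mono) auto
  finally have small: "L2_set (\<lambda>i. \<xi> $ i) {..<n} \<le> \<kappa> * L2_set (\<lambda>i. du $ i) {..<n}" .
  obtain \<alpha> where \<alpha>: "0 < \<alpha>"
    "\<And>i. i < n \<Longrightarrow> 0 < w i + \<alpha> * du $ i" "\<And>i. i < n \<Longrightarrow> 0 < w i + \<alpha> * dv $ i"
    "(n + \<nu>) * ln (\<Sum>i<n. (w i + \<alpha> * du $ i) * (w i + \<alpha> * dv $ i))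
        - (\<Sum>i<n. ln ((w i + \<alpha> * du $ i) * (w i + \<alpha> * dv $ i)))
      \<le> (n + \<nu>) * ln (\<Sum>i<n. (w i)\<^sup>2) - (\<Sum>i<n. ln ((w i)\<^sup>2)) - 0.15 * (1 - \<kappa>) ^ 4"
  proof (rule scaled_potential_reduction[of "{..<n}" w \<nu> \<mu> \<kappa> "\<lambda>i. r $ i"
        "\<lambda>i. du $ i" "\<lambda>i. dv $ i" "\<lambda>i. \<xi> $ i"])
    show "\<mu> = (\<Sum>i<n. (w i)\<^sup>2) / (card {..<n} + \<nu>)"
      using f(1) by (simp add: \<mu>_def gap_param_def gap)
  qed (use n \<nu> \<kappa> w r entry orth angle small in auto)
  define x' where "x' = x + \<alpha> \<cdot>\<^sub>v dx"
  define z' where "z' = z + \<alpha> \<cdot>\<^sub>v dz"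
  have car': "x' \<in> carrier_vec n" "z' \<in> carrier_vec n" using f(1,3) by (auto simp: x'_def z'_def dx dz)
  have x'_nth: "x' $ i = sqrt (x $ i) / sqrt (z $ i) * (w i + \<alpha> * du $ i)"
    and z'_nth: "z' $ i = sqrt (z $ i) / sqrt (x $ i) * (w i + \<alpha> * dv $ i)" if "i < n" for i
    using f(1,3) f(6,7)[OF that] that
    by (simp_all add: x'_def z'_def dx dz w_def real_sqrt_mult distrib_left)
  have "0 < x' $ i" "0 < z' $ i" if "i < n" for i
    using \<alpha>(2,3) f(6,7) that by (auto simp: x'_nth z'_nth)
  then have pos': "positive_vec x'" "positive_vec z'" using car' by (auto simp: positive_vec_def)
  have prod': "x' $ i * z' $ i = (w i + \<alpha> * du $ i) * (w i + \<alpha> * dv $ i)" if "i < n" for i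
    using f(6,7)[OF that] by (simp add: x'_nth z'_nth that)
  have gap': "x' \<bullet> z' = (\<Sum>i<n. (w i + \<alpha> * du $ i) * (w i + \<alpha> * dv $ i))"
    unfolding scalar_prod_eq_sum_lessThan[OF car'(2)] using prod' by (intro sum.cong) auto
  have "potential \<nu> x' z' \<le> potential \<nu> x z - reduction \<kappa>"
    using \<alpha>(4) f(1) car' w(2) prod'
    by (simp add: potential_def gap gap' reduction_def)
  then show ?thesis
    using \<alpha>(1) pos' by (auto simp: acceptable_move_def d x'_def z'_def)
qed

section \<open>Counting the iterations\<close>

text \<open>By \<open>sum_ln_le_ln_mean\<close> the barrier sum is at most
  \<open>n * ln (x \<bullet> z) - n * ln n\<close>; the last term cancels the normalization in the
  potential.\<close>

lemma potential_ge_ln_gap: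
  assumes "x \<in> carrier_vec n" "z \<in> carrier_vec n" "0 < n"
    and pos: "\<And>i. i < n \<Longrightarrow> 0 < x $ i" "\<And>i. i < n \<Longrightarrow> 0 < z $ i"
  shows "\<nu> * ln (x \<bullet> z) \<le> potential \<nu> x z"
proof -
  have gap: "x \<bullet> z = (\<Sum>i<n. x $ i * z $ i)" by (rule scalar_prod_eq_sum_lessThan) fact
  then have "0 < x \<bullet> z" using assms by (auto intro!: sum_pos)
  moreover have "(\<Sum>i<n. ln (x $ i * z $ i)) \<le> n * ln (x \<bullet> z / n)"
    using sum_ln_le_ln_mean[of "{..<n}" "\<lambda>i. x $ i * z $ i"] assms gap by auto
  ultimately show ?thesis
    using assms(1,3) by (simp add: potential_def ln_div algebra_simps)
qed

text \<open>Feasibility and the accumulated decrease are carried together, since preserving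
  feasibility needs the previous iterate to be feasible.\<close>

lemma run_invariant:
  assumes A: "A \<in> carrier_mat m n" and feas: "(x0, y0, z0) \<in> strictly_feasible A b c"
    and run: "algorithm_run A b c \<nu> \<kappa> \<epsilon> (x0, y0, z0) N s" and "k \<le> N"
  shows "\<exists>x y z. s k = (x, y, z) \<and> (x, y, z) \<in> strictly_feasible A b c
    \<and> potential \<nu> x z \<le> potential \<nu> x0 z0 - k * reduction \<kappa>"
  using \<open>k \<le> N\<close>
proof (induction k)
  case 0
  then show ?case using run feas by (simp add: algorithm_run_def)
next
  case (Suc k)
  then obtain x y z where k: "s k = (x, y, z)" "(x, y, z) \<in> strictly_feasible A b c"
    "potential \<nu> x z \<le> potential \<nu> x0 z0 - k * reduction \<kappa>" by auto
  have "algorithm_step A b c \<nu> \<kappa> \<epsilon> (s k) (s (Suc k))"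
    using run Suc.prems by (simp add: algorithm_run_def)
  then obtain dx dy dz \<alpha> where step: "search_direction A b c \<nu> \<kappa> (x, y, z) (dx, dy, dz)"
    "s (Suc k) = (x + \<alpha> \<cdot>\<^sub>v dx, y + \<alpha> \<cdot>\<^sub>v dy, z + \<alpha> \<cdot>\<^sub>v dz)"
    "acceptable_move \<nu> \<kappa> (x, y, z) (s (Suc k))"
    by (auto simp: algorithm_step_def k(1))
  have acc: "positive_vec (x + \<alpha> \<cdot>\<^sub>v dx)" "positive_vec (z + \<alpha> \<cdot>\<^sub>v dz)"
    "potential \<nu> (x + \<alpha> \<cdot>\<^sub>v dx) (z + \<alpha> \<cdot>\<^sub>v dz) \<le> potential \<nu> x z - reduction \<kappa>"
    using step(3) by (auto simp: acceptable_move_def step(2))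
  show ?case
    using step(2) strictly_feasible_move[OF A k(2) step(1) acc(1,2)] acc(3) k(3)
    by (auto simp: algebra_simps)
qed

text \<open>The two O-hypotheses become inequalities with arbitrary constants \<open>C1\<close> and
  \<open>C2\<close>. Quantifying \<open>K\<close> before the dimensions and the data makes it depend
  on \<open>\<kappa>\<close>, \<open>C1\<close> and \<open>C2\<close> alone.\<close>

theorem theorem1:
  fixes \<kappa> C1 C2 :: real
  assumes "0 \<le> \<kappa>" and "\<kappa> < 1"
  shows "\<exists>K>0. \<forall>(m::nat) (n::nat) (A::real mat) (b::real vec) (c::real vec)
             (\<nu>::real) (\<epsilon>::real) (L::real) (x0::real vec) (y0::real vec) (z0::real vec).
           A \<in> carrier_mat m n \<longrightarrow> vec_space.rank m A = m \<longrightarrow>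
           b \<in> carrier_vec m \<longrightarrow> c \<in> carrier_vec n \<longrightarrow>
           (x0, y0, z0) \<in> strictly_feasible A b c \<longrightarrow>
           sqrt (real n) \<le> \<nu> \<longrightarrow> 0 < \<epsilon> \<longrightarrow> 0 \<le> L \<longrightarrow>
           potential \<nu> x0 z0 \<le> C1 * (\<nu> * L) \<longrightarrow> ln (1 / \<epsilon>) \<le> C2 * L \<longrightarrow>
           terminates_within A b c \<nu> \<kappa> \<epsilon> (x0, y0, z0) \<lceil>K * (\<nu> * L)\<rceil>"
proof -
  define \<delta> where "\<delta> = reduction \<kappa>"
  have \<delta>: "0 < \<delta>" using assms by (simp add: \<delta>_def reduction_def)
  \<comment> \<open>The maximum with 1 keeps \<open>K\<close> positive even if
    \<open>C1 + C2\<close> is not.\<close>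
  define K where "K = max 1 ((C1 + C2) / \<delta>)"
  have K: "0 < K" "C1 + C2 \<le> K * \<delta>"
    using \<delta> by (auto simp: K_def field_simps max_def)
  have "terminates_within A b c \<nu> \<kappa> \<epsilon> (x0, y0, z0) \<lceil>K * (\<nu> * L)\<rceil>"
    if A: "A \<in> carrier_mat m n" and rank: "vec_space.rank m A = m"
      and feas: "(x0, y0, z0) \<in> strictly_feasible A b c"
      and \<nu>: "sqrt (real n) \<le> \<nu>" and \<epsilon>: "0 < \<epsilon>" and L: "0 \<le> L"
      and pot: "potential \<nu> x0 z0 \<le> C1 * (\<nu> * L)" and prec: "ln (1 / \<epsilon>) \<le> C2 * L"
    for m n A b c \<nu> \<epsilon> L x0 y0 z0
    unfolding terminates_within_def
  proof (intro allI impI conjI)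
    fix N s assume run: "algorithm_run A b c \<nu> \<kappa> \<epsilon> (x0, y0, z0) N s"
    have \<nu>0: "0 \<le> \<nu>" using \<nu> by (rule order_trans[rotated]) simp
    \<comment> \<open>In dimension zero the gap is 0, which already passes the stopping
      test.\<close>
    have n_pos: "0 < n" if "(x, y, z) \<in> strictly_feasible A b c" "\<not> stopped \<epsilon> (x, y, z)" for x y z
      using that strictly_feasibleD(3)[OF that(1) A] \<epsilon>
      by (cases "n = 0") (auto simp: stopped_def scalar_prod_eq_sum_lessThan)
    show "int N \<le> \<lceil>K * (\<nu> * L)\<rceil>"
    proof (cases N)
      case 0
      have "0 \<le> K * (\<nu> * L)" using K \<nu>0 L by simp
      then show ?thesis using 0 by linarith
    next
      \<comment> \<open>The last iterate may be stopped, so the lower bound on the potential is used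
        one step earlier, where a step was still taken. The strict bound on \<open>k\<close> then
        yields the ceiling bound for \<open>Suc k\<close>.\<close>
      case (Suc k)
      obtain x y z where k: "s k = (x, y, z)" "(x, y, z) \<in> strictly_feasible A b c"
        "potential \<nu> x z \<le> potential \<nu> x0 z0 - k * \<delta>"
        using run_invariant[OF A feas run, of k] Suc by (auto simp: \<delta>_def)
      have ns: "\<not> stopped \<epsilon> (x, y, z)"
        using run Suc k(1) by (auto simp: algorithm_run_def algorithm_step_def)
      have n: "0 < n" using n_pos k(2) ns by blast
      then have \<nu>_pos: "0 < \<nu>" using \<nu> by (smt (verit) of_nat_0_less_iff real_sqrt_gt_zero)
      have "ln \<epsilon> < ln (x \<bullet> z)" using ns \<epsilon> by (simp add: stopped_def)
      then have "\<nu> * ln \<epsilon> < \<nu> * ln (x \<bullet> z)" using \<nu>_pos by simp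
      also have "\<dots> \<le> potential \<nu> x z"
        using strictly_feasibleD[OF k(2) A] n by (intro potential_ge_ln_gap) auto
      also have "\<dots> \<le> C1 * (\<nu> * L) - k * \<delta>" using k(3) pot by simp
      finally have "k * \<delta> < C1 * (\<nu> * L) + \<nu> * ln (1 / \<epsilon>)" using \<epsilon> by (simp add: ln_div)
      also have "\<dots> \<le> C1 * (\<nu> * L) + \<nu> * (C2 * L)"
        using prec \<nu>0 by (intro add_left_mono mult_left_mono) auto
      also have "\<dots> = (C1 + C2) * (\<nu> * L)" by (simp add: algebra_simps)
      also have "\<dots> \<le> K * \<delta> * (\<nu> * L)" using K(2) \<nu>0 L by (intro mult_right_mono) auto
      finally have "k * \<delta> < (K * (\<nu> * L)) * \<delta>" by (simp add: mult_ac)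
      then have "k < K * (\<nu> * L)" using \<delta> by simp
      then show ?thesis using Suc by linarith
    qed
    assume ns: "\<not> stopped \<epsilon> (s N)"
    obtain x y z where s: "s N = (x, y, z)" "(x, y, z) \<in> strictly_feasible A b c"
      using run_invariant[OF A feas run order_refl] by auto
    show "\<exists>d. search_direction A b c \<nu> \<kappa> (s N) d"
      unfolding s(1) using A rank s(2) assms(1) by (rule search_direction_exists)
    show "\<exists>\<alpha>>0. acceptable_move \<nu> \<kappa> (s N) (move \<alpha> d (s N))"
      if "search_direction A b c \<nu> \<kappa> (s N) d" for d
      using acceptable_step_size_exists[OF A s(2) that[unfolded s(1)] _ \<nu> assms] n_pos s ns
      by auto
  qed
  then show ?thesis using K(1) by blast
qed

end
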